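(* Let $L$ and $M$ be finite-dimensional non-abelian Lie algebras over a finite field $\mathbb{F}_q$. If $L$ and $M$ are isoclinic, then $d(L)=d(M)$.
   Context: For a finite-dimensional Lie algebra $L$ over the finite field $\mathbb{F}_q$ (so $L$ is a finite set), the commutativity degree of $L$ is $d(L)=\dfrac{|\{(x,y)\in L\times L \mid [x,y]=0\}|}{|L|^{2}}$. $Z(L)$ is the center of $L$ and $L^{2}=[L,L]$ its derived subalgebra. Two Lie algebras $L$ and $M$ over $\mathbb{F}_q$ are called isoclinic if there are Lie algebra isomorphisms $\alpha: L/Z(L)\to M/Z(M)$ and $\beta: L^{2}\to M^{2}$ that are compatible with the bracket maps $L/Z(L)\times L/Z(L)\to L^{2}$, $(x+Z(L),y+Z(L))\mapsto [x,y]$, and $M/Z(M)\times M/Z(M)\to M^{2}$, $(x'+Z(M),y'+Z(M))\mapsto [x',y']$; that is, $\beta([x,y])=[x',y']$ whenever $x,y\in L$, $x',y'\in M$ satisfy $\alpha(x+Z(L))=x'+Z(M)$ and $\alpha(y+Z(L))=y'+Z(M)$. *)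

theory Defs
  imports Complex_Main "HOL-Algebra.Module" "HOL-Algebra.QuotRing"
begin

text \<open>A Lie algebra is encoded as a \<^const>\<open>module\<close> record over a field whose
  multiplication field holds the Lie bracket, so \<open>x \<otimes>\<^bsub>L\<^esub> y\<close> stands for \<open>[x, y]\<close>.
  The \<open>one\<close> field of the record is meaningless and never used.\<close>

locale lie_algebra = module R L + field R for R (structure) and L (structure) +
  assumes bracket_closed:
      "\<lbrakk>x \<in> carrier L; y \<in> carrier L\<rbrakk> \<Longrightarrow> x \<otimes>\<^bsub>L\<^esub> y \<in> carrier L"
    and bracket_add_left:
      "\<lbrakk>x \<in> carrier L; y \<in> carrier L; z \<in> carrier L\<rbrakk> \<Longrightarrow>
        (x \<oplus>\<^bsub>L\<^esub> y) \<otimes>\<^bsub>L\<^esub> z = (x \<otimes>\<^bsub>L\<^esub> z) \<oplus>\<^bsub>L\<^esub> (y \<otimes>\<^bsub>L\<^esub> z)"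
    and bracket_add_right:
      "\<lbrakk>x \<in> carrier L; y \<in> carrier L; z \<in> carrier L\<rbrakk> \<Longrightarrow>
        x \<otimes>\<^bsub>L\<^esub> (y \<oplus>\<^bsub>L\<^esub> z) = (x \<otimes>\<^bsub>L\<^esub> y) \<oplus>\<^bsub>L\<^esub> (x \<otimes>\<^bsub>L\<^esub> z)"
    and bracket_smult_left:
      "\<lbrakk>a \<in> carrier R; x \<in> carrier L; y \<in> carrier L\<rbrakk> \<Longrightarrow>
        (a \<odot>\<^bsub>L\<^esub> x) \<otimes>\<^bsub>L\<^esub> y = a \<odot>\<^bsub>L\<^esub> (x \<otimes>\<^bsub>L\<^esub> y)"
    and bracket_smult_right:
      "\<lbrakk>a \<in> carrier R; x \<in> carrier L; y \<in> carrier L\<rbrakk> \<Longrightarrow>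
        x \<otimes>\<^bsub>L\<^esub> (a \<odot>\<^bsub>L\<^esub> y) = a \<odot>\<^bsub>L\<^esub> (x \<otimes>\<^bsub>L\<^esub> y)"
    and bracket_self:
      "x \<in> carrier L \<Longrightarrow> x \<otimes>\<^bsub>L\<^esub> x = \<zero>\<^bsub>L\<^esub>"
    and jacobi:
      "\<lbrakk>x \<in> carrier L; y \<in> carrier L; z \<in> carrier L\<rbrakk> \<Longrightarrow>
        (x \<otimes>\<^bsub>L\<^esub> (y \<otimes>\<^bsub>L\<^esub> z)) \<oplus>\<^bsub>L\<^esub> (y \<otimes>\<^bsub>L\<^esub> (z \<otimes>\<^bsub>L\<^esub> x)) \<oplus>\<^bsub>L\<^esub> (z \<otimes>\<^bsub>L\<^esub> (x \<otimes>\<^bsub>L\<^esub> y)) = \<zero>\<^bsub>L\<^esub>"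

definition lin_span :: "('a, 'r) ring_scheme \<Rightarrow> ('a, 'b, 'm) module_scheme \<Rightarrow> 'b set \<Rightarrow> 'b set" where
  "lin_span R L S =
    {finsum L (\<lambda>b. c b \<odot>\<^bsub>L\<^esub> b) B | B c. finite B \<and> B \<subseteq> S \<and> c \<in> B \<rightarrow> carrier R}"

definition lin_indep :: "('a, 'r) ring_scheme \<Rightarrow> ('a, 'b, 'm) module_scheme \<Rightarrow> 'b set \<Rightarrow> bool" where
  "lin_indep R L S \<longleftrightarrow>
    (\<forall>B c. finite B \<and> B \<subseteq> S \<and> c \<in> B \<rightarrow> carrier R \<and>
      finsum L (\<lambda>b. c b \<odot>\<^bsub>L\<^esub> b) B = \<zero>\<^bsub>L\<^esub> \<longrightarrow> (\<forall>b\<in>B. c b = \<zero>\<^bsub>R\<^esub>))"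

definition finite_dim :: "('a, 'r) ring_scheme \<Rightarrow> ('a, 'b, 'm) module_scheme \<Rightarrow> bool" where
  "finite_dim R L \<longleftrightarrow>
    (\<exists>B. finite B \<and> B \<subseteq> carrier L \<and> lin_indep R L B \<and> lin_span R L B = carrier L)"

definition lie_abelian :: "('a, 'b, 'm) module_scheme \<Rightarrow> bool" where
  "lie_abelian L \<longleftrightarrow> (\<forall>x\<in>carrier L. \<forall>y\<in>carrier L. x \<otimes>\<^bsub>L\<^esub> y = \<zero>\<^bsub>L\<^esub>)"

definition lie_center :: "('a, 'b, 'm) module_scheme \<Rightarrow> 'b set" where
  "lie_center L = {z \<in> carrier L. \<forall>x\<in>carrier L. z \<otimes>\<^bsub>L\<^esub> x = \<zero>\<^bsub>L\<^esub>}"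

definition lie_derived :: "('a, 'r) ring_scheme \<Rightarrow> ('a, 'b) module \<Rightarrow> ('a, 'b) module" where
  "lie_derived R L =
    L\<lparr>carrier := lin_span R L {x \<otimes>\<^bsub>L\<^esub> y | x y. x \<in> carrier L \<and> y \<in> carrier L}\<rparr>"

text \<open>The quotient \<open>L/I\<close> by an ideal, with the cosets \<open>I +>\<^bsub>L\<^esub> x\<close> as elements; the scalar
  action and bracket are formed on representatives, in the style of \<^const>\<open>FactRing\<close>.\<close>

definition lie_quotient :: "('a, 'b) module \<Rightarrow> 'b set \<Rightarrow> ('a, 'b set) module" where
  "lie_quotient L I =
    \<lparr>carrier = a_rcosets\<^bsub>L\<^esub> I, mult = rcoset_mult L I, one = undefined,
     zero = I, add = set_add L, smult = (\<lambda>a X. \<Union>x\<in>X. I +>\<^bsub>L\<^esub> (a \<odot>\<^bsub>L\<^esub> x))\<rparr>"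

definition lie_iso :: "('a, 'r) ring_scheme \<Rightarrow> ('a, 'b, 'm) module_scheme \<Rightarrow>
    ('a, 'c, 'n) module_scheme \<Rightarrow> ('b \<Rightarrow> 'c) set" where
  "lie_iso R L M =
    {h. bij_betw h (carrier L) (carrier M) \<and>
      (\<forall>x\<in>carrier L. \<forall>y\<in>carrier L. h (x \<oplus>\<^bsub>L\<^esub> y) = h x \<oplus>\<^bsub>M\<^esub> h y) \<and>
      (\<forall>a\<in>carrier R. \<forall>x\<in>carrier L. h (a \<odot>\<^bsub>L\<^esub> x) = a \<odot>\<^bsub>M\<^esub> h x) \<and>
      (\<forall>x\<in>carrier L. \<forall>y\<in>carrier L. h (x \<otimes>\<^bsub>L\<^esub> y) = h x \<otimes>\<^bsub>M\<^esub> h y)}"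

definition isoclinic :: "('a, 'r) ring_scheme \<Rightarrow> ('a, 'b) module \<Rightarrow> ('a, 'c) module \<Rightarrow> bool" where
  "isoclinic R L M \<longleftrightarrow>
    (\<exists>\<alpha> \<beta>. \<alpha> \<in> lie_iso R (lie_quotient L (lie_center L)) (lie_quotient M (lie_center M)) \<and>
      \<beta> \<in> lie_iso R (lie_derived R L) (lie_derived R M) \<and>
      (\<forall>x\<in>carrier L. \<forall>y\<in>carrier L. \<forall>x'\<in>carrier M. \<forall>y'\<in>carrier M.
        \<alpha> (lie_center L +>\<^bsub>L\<^esub> x) = lie_center M +>\<^bsub>M\<^esub> x' \<and>
        \<alpha> (lie_center L +>\<^bsub>L\<^esub> y) = lie_center M +>\<^bsub>M\<^esub> y' \<longrightarrow>
        \<beta> (x \<otimes>\<^bsub>L\<^esub> y) = x' \<otimes>\<^bsub>M\<^esub> y'))"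

text \<open>Only meaningful when the carrier is finite, as \<^const>\<open>card\<close> is \<open>0\<close> on infinite sets.\<close>

definition comm_degree :: "('a, 'b, 'm) module_scheme \<Rightarrow> real" where
  "comm_degree L =
    real (card {(x, y). x \<in> carrier L \<and> y \<in> carrier L \<and> x \<otimes>\<^bsub>L\<^esub> y = \<zero>\<^bsub>L\<^esub>}) / real (card (carrier L)) ^ 2"

end

theory Submission
  imports Defs
begin

text \<open>Whether \<open>x\<close> and \<open>y\<close> commute depends only on their cosets modulo the center, and all these
  cosets have \<open>|Z(L)|\<close> elements, so \<open>d(L)\<close> is the proportion of commuting pairs in
  \<open>L/Z(L) \<times> L/Z(L)\<close>. An isoclinism \<open>(\<alpha>, \<beta>)\<close> induces a bijection between the commuting coset
  pairs of \<open>L\<close> and \<open>M\<close>, because \<open>\<beta>\<close> is injective and \<open>\<beta> 0 = 0\<close>.\<close>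

text \<open>The bracket here takes values in L, not in L/Z(L). Asking that two cosets commute in the
  quotient algebra would only mean that [x, y] is central, which is weaker; hence the pairs are
  described through commuting representatives.\<close>

definition commuting_coset_pairs :: "('a, 'b, 'm) module_scheme \<Rightarrow> ('b set \<times> 'b set) set" where
  "commuting_coset_pairs L =
    {(lie_center L +>\<^bsub>L\<^esub> x, lie_center L +>\<^bsub>L\<^esub> y) | x y.
      x \<in> carrier L \<and> y \<in> carrier L \<and> x \<otimes>\<^bsub>L\<^esub> y = \<zero>\<^bsub>L\<^esub>}"

section \<open>Linear spans and finiteness\<close>

lemma finite_lin_span:
  assumes "module R L" "finite (carrier R)" "finite B" "B \<subseteq> carrier L"
  shows "finite (lin_span R L B)"
proof -
  interpret module R L by fact
  let ?F = "\<lambda>C c. finsum L (\<lambda>b. c b \<odot>\<^bsub>L\<^esub> b) C"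
  \<comment> \<open>Coefficient functions are total on the type, so there may be infinitely many. A
    sum over \<open>C\<close> sees only their values on \<open>C\<close>, so the extensional
    functions on subsets of \<open>B\<close> already give every combination, and these are finite in
    number.\<close>
  have "lin_span R L B \<subseteq> (\<Union>C\<in>Pow B. ?F C ` (C \<rightarrow>\<^sub>E carrier R))"
  proof
    fix v assume "v \<in> lin_span R L B"
    then obtain C c where v: "v = ?F C c" and C: "finite C" "C \<subseteq> B" "c \<in> C \<rightarrow> carrier R"
      unfolding lin_span_def by blast
    have "?F C c = ?F C (restrict c C)"
      using C assms(4) by (intro M.finsum_cong') (auto simp: Pi_iff)
    moreover have "restrict c C \<in> C \<rightarrow>\<^sub>E carrier R"
      using C by auto
    ultimately show "v \<in> (\<Union>C\<in>Pow B. ?F C ` (C \<rightarrow>\<^sub>E carrier R))"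
      using v C by blast
  qed
  moreover have "finite (\<Union>C\<in>Pow B. ?F C ` (C \<rightarrow>\<^sub>E carrier R))"
  proof (intro finite_UN_I finite_imageI)
    show "finite (C \<rightarrow>\<^sub>E carrier R)" if "C \<in> Pow B" for C
      using that assms(2,3) finite_subset[of C B] by (intro finite_PiE) auto
  qed (use assms(3) in simp)
  ultimately show ?thesis
    by (rule finite_subset)
qed

lemma finite_carrier_of_finite_dim:
  assumes "module R L" "finite (carrier R)" "finite_dim R L"
  shows "finite (carrier L)"
proof -
  obtain B where "finite B" "B \<subseteq> carrier L" "lin_span R L B = carrier L"
    using assms(3) unfolding finite_dim_def by blast
  then show ?thesis
    using finite_lin_span[OF assms(1,2)] by metis
qed

lemma lin_span_superset:
  assumes "module R L" "S \<subseteq> carrier L"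
  shows "S \<subseteq> lin_span R L S"
proof
  interpret module R L by fact
  fix x assume "x \<in> S"
  moreover have "finsum L (\<lambda>b. \<one>\<^bsub>R\<^esub> \<odot>\<^bsub>L\<^esub> b) {x} = x"
    using \<open>x \<in> S\<close> assms(2) by (subst M.finsum_insert) auto
  ultimately show "x \<in> lin_span R L S"
    unfolding lin_span_def
    by (auto intro!: exI[of _ "{x}"] exI[of _ "\<lambda>_. \<one>\<^bsub>R\<^esub>"])
qed

lemma lin_span_subset_carrier:
  assumes "module R L" "S \<subseteq> carrier L"
  shows "lin_span R L S \<subseteq> carrier L"
proof -
  interpret module R L by fact
  show ?thesis
    using assms(2) unfolding lin_span_def by (auto intro!: M.finsum_closed simp: Pi_iff)
qed

section \<open>The bracket modulo the center\<close>

context lie_algebra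
begin

lemma bracket_zero_left:
  assumes "x \<in> carrier L"
  shows "\<zero>\<^bsub>L\<^esub> \<otimes>\<^bsub>L\<^esub> x = \<zero>\<^bsub>L\<^esub>"
  \<comment> \<open>Zero is written as the scalar 0 times the zero vector; pulling the scalar out of
    the bracket leaves 0.\<close>
  using bracket_smult_left[of "\<zero>" "\<zero>\<^bsub>L\<^esub>" x] assms bracket_closed by simp

lemma bracket_antisym:
  assumes "x \<in> carrier L" "y \<in> carrier L"
  shows "(x \<otimes>\<^bsub>L\<^esub> y) \<oplus>\<^bsub>L\<^esub> (y \<otimes>\<^bsub>L\<^esub> x) = \<zero>\<^bsub>L\<^esub>"
proof -
  \<comment> \<open>Expand the square of x + y by bilinearity; it is 0, as are the squares of x and
    y.\<close>
  have "(x \<oplus>\<^bsub>L\<^esub> y) \<otimes>\<^bsub>L\<^esub> (x \<oplus>\<^bsub>L\<^esub> y) = (x \<otimes>\<^bsub>L\<^esub> y) \<oplus>\<^bsub>L\<^esub> (y \<otimes>\<^bsub>L\<^esub> x)"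
    using assms by (simp add: bracket_add_left bracket_add_right bracket_self[of x] bracket_self[of y]
        bracket_closed M.a_comm)
  with assms show ?thesis
    by (simp add: bracket_self)
qed

text \<open>\<open>lie_center\<close> puts the central element in the left slot; antisymmetry
  carries the vanishing over to the right slot.\<close>

lemma bracket_center_right:
  assumes "x \<in> carrier L" "z \<in> lie_center L"
  shows "x \<otimes>\<^bsub>L\<^esub> z = \<zero>\<^bsub>L\<^esub>"
  using bracket_antisym[of x z] assms bracket_closed[of x z] by (simp add: lie_center_def)

text \<open>This is the well-definedness of the bracket map L/Z(L) \<times> L/Z(L) \<rightarrow>
  L^2: by bilinearity, every extra term has a central entry. The shifts stand on the left to match
  the elements of \<open>lie_center L +> x\<close>.\<close>

lemma bracket_center_shift:
  assumes "x \<in> carrier L" "y \<in> carrier L" "z \<in> lie_center L" "w \<in> lie_center L"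
  shows "(z \<oplus>\<^bsub>L\<^esub> x) \<otimes>\<^bsub>L\<^esub> (w \<oplus>\<^bsub>L\<^esub> y) = x \<otimes>\<^bsub>L\<^esub> y"
proof -
  have "z \<in> carrier L" "w \<in> carrier L" and [simp]: "z \<otimes>\<^bsub>L\<^esub> y = \<zero>\<^bsub>L\<^esub>" "z \<otimes>\<^bsub>L\<^esub> w = \<zero>\<^bsub>L\<^esub>"
    using assms by (auto simp: lie_center_def)
  then show ?thesis
    using assms(1,2) bracket_center_right[OF assms(1,4)]
    by (simp add: bracket_add_left bracket_add_right bracket_closed)
qed

text \<open>Opens up the general coset facts used in the count: disjointness, equal size and
  Lagrange's theorem.\<close>

lemma abelian_subgroup_lie_center: "abelian_subgroup (lie_center L) L"
proof -
  have inv: "\<ominus>\<^bsub>L\<^esub> z \<in> lie_center L" if z: "z \<in> lie_center L" for z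
  proof -
    have zL: "z \<in> carrier L" and z0: "\<And>x. x \<in> carrier L \<Longrightarrow> z \<otimes>\<^bsub>L\<^esub> x = \<zero>\<^bsub>L\<^esub>"
      using z by (auto simp: lie_center_def)
    have "(\<ominus>\<^bsub>L\<^esub> z) \<otimes>\<^bsub>L\<^esub> x = \<zero>\<^bsub>L\<^esub>" if x: "x \<in> carrier L" for x
    proof -
      \<comment> \<open>Expand [-z + z, x] = 0; the summand [z, x] is 0 because z is
        central.\<close>
      have "((\<ominus>\<^bsub>L\<^esub> z) \<otimes>\<^bsub>L\<^esub> x) \<oplus>\<^bsub>L\<^esub> (z \<otimes>\<^bsub>L\<^esub> x) = \<zero>\<^bsub>L\<^esub>"
        using bracket_add_left[OF M.a_inv_closed[OF zL] zL x]
        by (simp only: M.l_neg[OF zL] bracket_zero_left[OF x])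
      then show ?thesis
        using bracket_closed[OF M.a_inv_closed[OF zL] x] by (simp only: z0[OF x] M.r_zero)
    qed
    with zL show ?thesis by (simp add: lie_center_def)
  qed
  have "subgroup (lie_center L) (add_monoid L)"
  proof (rule M.add.subgroupI)
    show "lie_center L \<subseteq> carrier L"
      by (auto simp: lie_center_def)
    show "lie_center L \<noteq> {}"
      using bracket_zero_left M.zero_closed unfolding lie_center_def by blast
    show "\<ominus>\<^bsub>L\<^esub> z \<in> lie_center L" if "z \<in> lie_center L" for z
      using inv[OF that] .
    show "z \<oplus>\<^bsub>L\<^esub> w \<in> lie_center L" if "z \<in> lie_center L" "w \<in> lie_center L" for z w
      using that by (simp add: lie_center_def bracket_add_left)
  qed
  then show ?thesis
    by (intro abelian_subgroupI3 additive_subgroupI M.abelian_group_axioms)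
qed

section \<open>Counting commuting pairs by cosets\<close>

lemma commuting_pairs_eq:
  "{(x, y). x \<in> carrier L \<and> y \<in> carrier L \<and> x \<otimes>\<^bsub>L\<^esub> y = \<zero>\<^bsub>L\<^esub>} =
    (\<Union>(X, Y)\<in>commuting_coset_pairs L. X \<times> Y)" (is "?C = ?U")
proof
  interpret Z: abelian_subgroup "lie_center L" L by (rule abelian_subgroup_lie_center)
  show "?C \<subseteq> ?U"
  proof clarify
    fix x y assume xy: "x \<in> carrier L" "y \<in> carrier L" "x \<otimes>\<^bsub>L\<^esub> y = \<zero>\<^bsub>L\<^esub>"
    then have "(lie_center L +>\<^bsub>L\<^esub> x, lie_center L +>\<^bsub>L\<^esub> y) \<in> commuting_coset_pairs L"
      unfolding commuting_coset_pairs_def by blast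
    moreover have "(x, y) \<in> (lie_center L +>\<^bsub>L\<^esub> x) \<times> (lie_center L +>\<^bsub>L\<^esub> y)"
      using xy by (simp add: Z.a_rcos_self)
    ultimately show "(x, y) \<in> ?U" by blast
  qed
  show "?U \<subseteq> ?C"
  proof clarify
    fix X Y u v
    assume "(X, Y) \<in> commuting_coset_pairs L" "u \<in> X" "v \<in> Y"
    then obtain x y z w where xy: "x \<in> carrier L" "y \<in> carrier L" "x \<otimes>\<^bsub>L\<^esub> y = \<zero>\<^bsub>L\<^esub>"
      and zw: "z \<in> lie_center L" "w \<in> lie_center L" and uv: "u = z \<oplus>\<^bsub>L\<^esub> x" "v = w \<oplus>\<^bsub>L\<^esub> y"
      unfolding commuting_coset_pairs_def a_r_coset_def' by blast
    \<comment> \<open>Each coset pair counts as a full block: u and v differ from commuting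
      representatives by central elements, which leave the bracket unchanged.\<close>
    show "u \<in> carrier L \<and> v \<in> carrier L \<and> u \<otimes>\<^bsub>L\<^esub> v = \<zero>\<^bsub>L\<^esub>"
      using bracket_center_shift[OF xy(1,2) zw] xy zw Z.a_subset unfolding uv by auto
  qed
qed

text \<open>The commuting pairs split into disjoint blocks X \<times> Y of |Z(L)|^2 elements, one
  for each commuting coset pair, while |L| is the number of cosets times |Z(L)|. The factor |Z(L)|^2
  cancels from the quotient.\<close>

lemma comm_degree_eq_cosets:
  assumes fin: "finite (carrier L)"
  shows "comm_degree L =
    real (card (commuting_coset_pairs L)) / real (card (a_rcosets\<^bsub>L\<^esub> (lie_center L))) ^ 2"
proof -
  interpret Z: abelian_subgroup "lie_center L" L by (rule abelian_subgroup_lie_center)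
  let ?Q = "commuting_coset_pairs L" and ?A = "a_rcosets\<^bsub>L\<^esub> (lie_center L)"
  have QA: "?Q \<subseteq> ?A \<times> ?A"
    using M.a_rcosetsI[OF Z.a_subset] unfolding commuting_coset_pairs_def by auto
  have finA: "finite ?A"
    using fin by (simp add: A_RCOSETS_def')
  then have finQ: "finite ?Q"
    using QA finite_subset by blast
  have finc: "finite X" and cardc: "card X = card (lie_center L)" if "X \<in> ?A" for X
    using that fin Z.a_subset Z.a_cosets_finite M.a_card_cosets_equal by auto
  have disj: "X = Y" if "X \<in> ?A" "Y \<in> ?A" "x \<in> X" "x \<in> Y" for X Y x
    using Z.a_rcos_disjoint that by (auto simp: pairwise_def disjnt_iff)
  have "card (\<Union>p\<in>?Q. fst p \<times> snd p) = (\<Sum>p\<in>?Q. card (fst p \<times> snd p))"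
  proof (rule card_UN_disjoint[OF finQ])
    show "\<forall>p\<in>?Q. finite (fst p \<times> snd p)"
      using QA finc by auto
    show "\<forall>p\<in>?Q. \<forall>q\<in>?Q. p \<noteq> q \<longrightarrow> (fst p \<times> snd p) \<inter> (fst q \<times> snd q) = {}"
    proof (intro ballI impI equals0I)
      fix p q r
      assume pq: "p \<in> ?Q" "q \<in> ?Q" "p \<noteq> q"
        and r: "r \<in> (fst p \<times> snd p) \<inter> (fst q \<times> snd q)"
      from pq QA have "fst p \<in> ?A" "fst q \<in> ?A" "snd p \<in> ?A" "snd q \<in> ?A"
        by (auto simp: mem_Times_iff)
      \<comment> \<open>A point shared by two blocks puts a common element into both first cosets
        and another into both second cosets, so the cosets agree in each coordinate.\<close>
      with r disj[of "fst p" "fst q" "fst r"] disj[of "snd p" "snd q" "snd r"] have "p = q"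
        by (simp add: prod_eq_iff mem_Times_iff)
      with pq show False by simp
    qed
  qed
  also have "\<dots> = (\<Sum>p\<in>?Q. card (lie_center L) ^ 2)"
    using QA cardc
    by (intro sum.cong) (auto simp: card_cartesian_product power2_eq_square)
  finally have C: "card {(x, y). x \<in> carrier L \<and> y \<in> carrier L \<and> x \<otimes>\<^bsub>L\<^esub> y = \<zero>\<^bsub>L\<^esub>} =
      card ?Q * card (lie_center L) ^ 2"
    unfolding commuting_pairs_eq by (simp add: case_prod_unfold)
  have carr: "card (carrier L) = card ?A * card (lie_center L)"
    using M.a_lagrange[OF fin Z.additive_subgroup_axioms] by (simp add: order_def)
  \<comment> \<open>The factor may be cancelled: the center contains 0 and is finite, so its
    cardinality is not 0.\<close>
  have "lie_center L \<noteq> {}"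
    using additive_subgroup.zero_closed[OF Z.additive_subgroup_axioms] by blast
  then have "real (card (lie_center L)) ^ 2 \<noteq> 0"
    using finite_subset[OF Z.a_subset fin] by simp
  then show ?thesis
    unfolding comm_degree_def C carr of_nat_mult of_nat_power power_mult_distrib
    by (rule nonzero_mult_divide_mult_cancel_right)
qed

lemma brackets_subset_carrier:
  "{x \<otimes>\<^bsub>L\<^esub> y | x y. x \<in> carrier L \<and> y \<in> carrier L} \<subseteq> carrier L"
  using bracket_closed by auto

end

section \<open>Transport of vanishing brackets along an isoclinism\<close>

lemma bracket_in_derived:
  assumes "lie_algebra R L" "x \<in> carrier L" "y \<in> carrier L"
  shows "x \<otimes>\<^bsub>L\<^esub> y \<in> carrier (lie_derived R L)"
proof -
  interpret lie_algebra R L by fact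
  show ?thesis
    using lin_span_superset[OF module_axioms brackets_subset_carrier] assms(2,3)
    unfolding lie_derived_def by auto
qed

lemma derived_subset_carrier:
  assumes "lie_algebra R L"
  shows "carrier (lie_derived R L) \<subseteq> carrier L"
proof -
  interpret lie_algebra R L by fact
  show ?thesis
    using lin_span_subset_carrier[OF module_axioms brackets_subset_carrier]
    unfolding lie_derived_def by simp
qed

lemma zero_in_derived:
  assumes "lie_algebra R L"
  shows "\<zero>\<^bsub>L\<^esub> \<in> carrier (lie_derived R L)"
proof -
  interpret lie_algebra R L by fact
  show ?thesis
    \<comment> \<open>Zero is itself a bracket, namely [0, 0].\<close>
    using bracket_in_derived[OF assms M.zero_closed M.zero_closed] bracket_self[OF M.zero_closed]
    by simp
qed

lemma lie_iso_derived_eq_zero_iff: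
  assumes "lie_algebra R L" "lie_algebra R M"
    and \<beta>: "\<beta> \<in> lie_iso R (lie_derived R L) (lie_derived R M)"
    and v: "v \<in> carrier (lie_derived R L)"
  shows "\<beta> v = \<zero>\<^bsub>M\<^esub> \<longleftrightarrow> v = \<zero>\<^bsub>L\<^esub>"
proof -
  interpret L: lie_algebra R L by fact
  interpret M: lie_algebra R M by fact
  \<comment> \<open>\<open>lie_derived\<close> replaces only the carrier, so additivity can be
    stated with the sums of L and M themselves.\<close>
  have bij: "bij_betw \<beta> (carrier (lie_derived R L)) (carrier (lie_derived R M))"
    and add: "\<And>x y. x \<in> carrier (lie_derived R L) \<Longrightarrow> y \<in> carrier (lie_derived R L) \<Longrightarrow>
      \<beta> (x \<oplus>\<^bsub>L\<^esub> y) = \<beta> x \<oplus>\<^bsub>M\<^esub> \<beta> y"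
    using \<beta> by (auto simp: lie_iso_def lie_derived_def)
  have "\<beta> \<zero>\<^bsub>L\<^esub> \<in> carrier M"
    using bij_betwE[OF bij] zero_in_derived[OF assms(1)] derived_subset_carrier[OF assms(2)] by blast
  \<comment> \<open>The image of 0 is idempotent for addition in M, hence 0; injectivity then gives
    the equivalence.\<close>
  moreover have "\<beta> \<zero>\<^bsub>L\<^esub> = \<beta> \<zero>\<^bsub>L\<^esub> \<oplus>\<^bsub>M\<^esub> \<beta> \<zero>\<^bsub>L\<^esub>"
    using add[OF zero_in_derived[OF assms(1)] zero_in_derived[OF assms(1)]] by simp
  ultimately have "\<beta> \<zero>\<^bsub>L\<^esub> = \<zero>\<^bsub>M\<^esub>"
    using M.M.add.r_cancel_one' by simp
  then show ?thesis
    using inj_on_eq_iff[OF bij_betw_imp_inj_on[OF bij] v zero_in_derived[OF assms(1)]] by simp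
qed

text \<open>Applying \<alpha> in both coordinates is the required bijection. If \<alpha> sends the
  cosets of x, y to those of x', y', then \<beta> sends [x, y] to [x', y'], and \<beta> vanishes
  exactly at 0, so commuting is both preserved and reflected.\<close>

lemma card_commuting_coset_pairs_isoclinic:
  assumes L: "lie_algebra R L" and M: "lie_algebra R M"
    and \<alpha>: "bij_betw \<alpha> (a_rcosets\<^bsub>L\<^esub> (lie_center L)) (a_rcosets\<^bsub>M\<^esub> (lie_center M))"
    and \<beta>: "\<beta> \<in> lie_iso R (lie_derived R L) (lie_derived R M)"
    and comp: "\<And>x y x' y'. \<lbrakk>x \<in> carrier L; y \<in> carrier L; x' \<in> carrier M; y' \<in> carrier M;
        \<alpha> (lie_center L +>\<^bsub>L\<^esub> x) = lie_center M +>\<^bsub>M\<^esub> x';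
        \<alpha> (lie_center L +>\<^bsub>L\<^esub> y) = lie_center M +>\<^bsub>M\<^esub> y'\<rbrakk> \<Longrightarrow> \<beta> (x \<otimes>\<^bsub>L\<^esub> y) = x' \<otimes>\<^bsub>M\<^esub> y'"
  shows "card (commuting_coset_pairs L) = card (commuting_coset_pairs M)"
proof (rule bij_betw_same_card[of "map_prod \<alpha> \<alpha>"])
  let ?A = "a_rcosets\<^bsub>L\<^esub> (lie_center L)" and ?B = "a_rcosets\<^bsub>M\<^esub> (lie_center M)"
  have A: "?A = (\<lambda>x. lie_center L +>\<^bsub>L\<^esub> x) ` carrier L"
    and B: "?B = (\<lambda>x. lie_center M +>\<^bsub>M\<^esub> x) ` carrier M"
    by (auto simp: A_RCOSETS_def')
  have QA: "commuting_coset_pairs L \<subseteq> ?A \<times> ?A"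
    unfolding commuting_coset_pairs_def A by auto
  have key: "x \<otimes>\<^bsub>L\<^esub> y = \<zero>\<^bsub>L\<^esub> \<longleftrightarrow> x' \<otimes>\<^bsub>M\<^esub> y' = \<zero>\<^bsub>M\<^esub>"
    if "x \<in> carrier L" "y \<in> carrier L" "x' \<in> carrier M" "y' \<in> carrier M"
      "\<alpha> (lie_center L +>\<^bsub>L\<^esub> x) = lie_center M +>\<^bsub>M\<^esub> x'"
      "\<alpha> (lie_center L +>\<^bsub>L\<^esub> y) = lie_center M +>\<^bsub>M\<^esub> y'" for x y x' y'
    using lie_iso_derived_eq_zero_iff[OF L M \<beta> bracket_in_derived[OF L that(1,2)]] comp[OF that]
    by simp
  \<comment> \<open>\<open>key\<close> speaks of representatives. \<open>lift\<close> picks one for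
    the image of a coset, \<open>lower\<close> one for a preimage; the latter rests on the
    surjectivity of \<alpha>.\<close>
  have lift: "\<exists>x'\<in>carrier M. \<alpha> (lie_center L +>\<^bsub>L\<^esub> x) = lie_center M +>\<^bsub>M\<^esub> x'" if "x \<in> carrier L" for x
    using bij_betwE[OF \<alpha>] that unfolding A B by auto
  have lower: "\<exists>x\<in>carrier L. \<alpha> (lie_center L +>\<^bsub>L\<^esub> x) = lie_center M +>\<^bsub>M\<^esub> x'" if "x' \<in> carrier M" for x'
  proof -
    have "lie_center M +>\<^bsub>M\<^esub> x' \<in> \<alpha> ` ?A"
      using bij_betw_imp_surj_on[OF \<alpha>] that unfolding B by auto
    then show ?thesis unfolding A by (metis imageE)
  qed
  have "inj_on (map_prod \<alpha> \<alpha>) (?A \<times> ?A)"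
    using bij_betw_imp_inj_on[OF \<alpha>] by (intro map_prod_inj_on)
  then have "inj_on (map_prod \<alpha> \<alpha>) (commuting_coset_pairs L)"
    using QA by (rule inj_on_subset)
  moreover have "map_prod \<alpha> \<alpha> ` commuting_coset_pairs L = commuting_coset_pairs M"
  proof (intro equalityI subsetI)
    fix p assume "p \<in> map_prod \<alpha> \<alpha> ` commuting_coset_pairs L"
    then obtain x y where xy: "x \<in> carrier L" "y \<in> carrier L" "x \<otimes>\<^bsub>L\<^esub> y = \<zero>\<^bsub>L\<^esub>"
      and p: "p = (\<alpha> (lie_center L +>\<^bsub>L\<^esub> x), \<alpha> (lie_center L +>\<^bsub>L\<^esub> y))"
      unfolding commuting_coset_pairs_def by auto
    obtain x' y' where "x' \<in> carrier M" "y' \<in> carrier M"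
      "\<alpha> (lie_center L +>\<^bsub>L\<^esub> x) = lie_center M +>\<^bsub>M\<^esub> x'"
      "\<alpha> (lie_center L +>\<^bsub>L\<^esub> y) = lie_center M +>\<^bsub>M\<^esub> y'"
      using lift xy by meson
    with key[of x y x' y'] xy show "p \<in> commuting_coset_pairs M"
      unfolding p commuting_coset_pairs_def by auto
  next
    fix p assume "p \<in> commuting_coset_pairs M"
    then obtain x' y' where xy': "x' \<in> carrier M" "y' \<in> carrier M" "x' \<otimes>\<^bsub>M\<^esub> y' = \<zero>\<^bsub>M\<^esub>"
      and p: "p = (lie_center M +>\<^bsub>M\<^esub> x', lie_center M +>\<^bsub>M\<^esub> y')"
      unfolding commuting_coset_pairs_def by auto
    obtain x y where xy: "x \<in> carrier L" "y \<in> carrier L"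
      and eq: "\<alpha> (lie_center L +>\<^bsub>L\<^esub> x) = lie_center M +>\<^bsub>M\<^esub> x'"
      "\<alpha> (lie_center L +>\<^bsub>L\<^esub> y) = lie_center M +>\<^bsub>M\<^esub> y'"
      using lower xy' by meson
    \<comment> \<open>Surjectivity uses \<open>key\<close> from right to left: vanishing in M is
      pulled back to L.\<close>
    have "(lie_center L +>\<^bsub>L\<^esub> x, lie_center L +>\<^bsub>L\<^esub> y) \<in> commuting_coset_pairs L"
      using key[OF xy xy'(1,2) eq] xy xy'(3) unfolding commuting_coset_pairs_def by auto
    moreover have "p = map_prod \<alpha> \<alpha> (lie_center L +>\<^bsub>L\<^esub> x, lie_center L +>\<^bsub>L\<^esub> y)"
      using eq p by simp
    ultimately show "p \<in> map_prod \<alpha> \<alpha> ` commuting_coset_pairs L"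
      by (rule rev_image_eqI)
  qed
  ultimately show "bij_betw (map_prod \<alpha> \<alpha>) (commuting_coset_pairs L) (commuting_coset_pairs M)"
    by (simp add: bij_betw_def)
qed

theorem theorem3p6:
  fixes R :: "'a ring" and L :: "('a, 'b) module" and M :: "('a, 'c) module"
  assumes "field R" and "finite (carrier R)"
    and "lie_algebra R L" and "finite_dim R L" and "\<not> lie_abelian L"
    and "lie_algebra R M" and "finite_dim R M" and "\<not> lie_abelian M"
    and "isoclinic R L M"
  shows "comm_degree L = comm_degree M"
proof -
  interpret L: lie_algebra R L by fact
  interpret M: lie_algebra R M by fact
  obtain \<alpha> \<beta> where \<alpha>: "\<alpha> \<in> lie_iso R (lie_quotient L (lie_center L)) (lie_quotient M (lie_center M))"
    and \<beta>: "\<beta> \<in> lie_iso R (lie_derived R L) (lie_derived R M)"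
    and comp: "\<forall>x\<in>carrier L. \<forall>y\<in>carrier L. \<forall>x'\<in>carrier M. \<forall>y'\<in>carrier M.
        \<alpha> (lie_center L +>\<^bsub>L\<^esub> x) = lie_center M +>\<^bsub>M\<^esub> x' \<and>
        \<alpha> (lie_center L +>\<^bsub>L\<^esub> y) = lie_center M +>\<^bsub>M\<^esub> y' \<longrightarrow>
        \<beta> (x \<otimes>\<^bsub>L\<^esub> y) = x' \<otimes>\<^bsub>M\<^esub> y'"
    using \<open>isoclinic R L M\<close> unfolding isoclinic_def by blast
  \<comment> \<open>The carrier of \<open>lie_quotient\<close> is by definition the set of cosets,
    so this bijection also equates the denominators in the two coset formulas.\<close>
  have bij: "bij_betw \<alpha> (a_rcosets\<^bsub>L\<^esub> (lie_center L)) (a_rcosets\<^bsub>M\<^esub> (lie_center M))"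
    using \<alpha> by (simp add: lie_iso_def lie_quotient_def)
  have "card (commuting_coset_pairs L) = card (commuting_coset_pairs M)"
    using card_commuting_coset_pairs_isoclinic[OF assms(3,6) bij \<beta>] comp by blast
  moreover have "finite (carrier L)" "finite (carrier M)"
    using assms finite_carrier_of_finite_dim L.module_axioms M.module_axioms by blast+
  ultimately show ?thesis
    using bij_betw_same_card[OF bij] by (simp add: L.comm_degree_eq_cosets M.comm_degree_eq_cosets)
qed

end
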